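(* Let $f:\mathbb{R}^n\to\mathbb{R}$ and $g:\mathbb{R}^n\to\mathbb{R}^m$ be convex and differentiable ($g$ componentwise convex), and let $\mathcal{X}\subseteq\mathbb{R}^n$ be closed and convex. Assume that the problem of minimizing $f(x)$ subject to $g(x)\le0$, $x\in\mathcal{X}$, has a (bounded) optimizer and that Slater's condition holds, i.e., the feasible set $\{x\in\mathcal{X}\mid g(x)\le0\}$ has a non-empty relative interior. Let $\rho\ge0$, let $z^\star=(x^\star,\mu^\star)$ be any (primal-dual) solution of this problem, let $\mathcal{F}:=\{(x,\mu)\in\mathcal{Z}\mid g(x)\le0\}$, and let the zero-dissipation set be $$\mathcal{M}_{z^\star}:=\operatorname{cl}\{z\in\mathcal{Z}\mid\langle z-z^\star,[F(z)]^z_{\mathcal{Z}}\rangle=0\}.$$ Then: (i) If $\rho>0$ or $f$ is strictly convex, then $\mathcal{M}_{z^\star}\subseteq\mathcal{F}$. (ii) For all $(x,\mu)\in\mathcal{M}_{z^\star}$, $\nabla f(x)=\nabla f(x^\star)$. (iii) For all $(x,\mu)\in\mathcal{M}_{z^\star}$ and all $i=1,\dots,m$, $\mu_i^\star=0$ or $g_i(x)=g_i(x^\star)+\nabla g_i(x^\star)^T(x-x^\star)$. (iv) For all $(x,\mu)\in\mathcal{M}_{z^\star}$, $\nabla g(x)\mu=\nabla g(x^\star)\mu$. (v) For all $(x,\mu)\in\mathcal{M}_{z^\star}$ and all $i=1,\dots,m$, $g_i(x^\star)<0\Rightarrow\mu_i=0$. (vi) If, in addition, there is a solution of the problem satisfying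 strict complementary slackness, and $\mathcal{M}_{z^\star}$ is defined with respect to such a solution $z^\star$, i.e., one with $g_i(x^\star)=0\Rightarrow\mu_i^\star>0$ for all $i=1,\dots,m$, then for all $(x,\mu)\in\mathcal{M}_{z^\star}$ and all $i=1,\dots,m$: if $g_i(x^\star)=0$, then $\mu_i>0$ or $g_i(x)\ge0$.
   Context: Notation: $\langle\cdot,\cdot\rangle$ and $\|\cdot\|$ are the Euclidean inner product and norm, $\operatorname{cl}$ denotes closure, $\mathbb{R}^m_{\ge0}$ is the set of vectors with nonnegative entries, and inequalities and $\max$ between vectors are componentwise. $\nabla g(x)$ is the $n\times m$ matrix whose $i$-th column is the gradient $\nabla g_i(x)$. Tangent cone, normal cone, projection: for a closed convex set $\mathcal{C}\subseteq\mathbb{R}^k$ and $x\in\mathcal{C}$, $T_x\mathcal{C}:=\operatorname{cl}\{v\in\mathbb{R}^k\mid\exists\lambda>0:\ x+\lambda v\in\mathcal{C}\}$ and $N_x\mathcal{C}:=\{\eta\in\mathbb{R}^k\mid\langle v,\eta\rangle\le0\ \forall v\in T_x\mathcal{C}\}$. For $v\in\mathbb{R}^k$, $[v]^x_{\mathcal{C}}:=\arg\min_{w\in T_x\mathcal{C}}\|v-w\|^2$ is the projection of $v$ onto $T_x\mathcal{C}$. Optimization problem: minimize $f(x)$ subject to $g(x)\le0$, $x\in\mathcal{X}$. A (primal-dual) solution is a pair $(x^\star,\mu^\star)$ with $x^\star\in\mathcal{X}$, $g(x^\star)\le0$, $\mu^\star\in\mathbb{R}^m_{\ge0}$, $\nabla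 f(x^\star)+\nabla g(x^\star)\mu^\star\in-N_{x^\star}\mathcal{X}$, and for all $i$: $\mu_i^\star>0\Rightarrow g_i(x^\star)=0$. Vector field: $\mathcal{Z}:=\mathcal{X}\times\mathbb{R}^m_{\ge0}$, $z=(x,\mu)\in\mathcal{Z}$, and for the augmentation parameter $\rho\ge0$ the augmented partial Lagrangian is $L(x,\mu)=f(x)+\mu^Tg(x)+\tfrac{\rho}{2}\|\max\{0,g(x)\}\|^2$. Set $F(z):=(-\nabla_xL(x,\mu),\ \nabla_\mu L(x,\mu))=\big(-\nabla f(x)-\nabla g(x)(\mu+\rho\max\{0,g(x)\}),\ g(x)\big)$.
   Formalization: Part (vi) is proved for the points z in Z with <z - z*, [F(z)]> = 0, not for their closure M; on the closure it fails, e.g. for f(x) = x, g(x) = -x, X = R, z* = (0,1), at the point (1,0). *)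

theory Defs
  imports "HOL-Analysis.Analysis"
begin

section \<open>Convex analysis\<close>

definition strictly_convex_on :: "'a::real_vector set \<Rightarrow> ('a \<Rightarrow> real) \<Rightarrow> bool" where
  "strictly_convex_on S f \<longleftrightarrow> convex S \<and>
     (\<forall>x\<in>S. \<forall>y\<in>S. \<forall>t. x \<noteq> y \<longrightarrow> 0 < t \<longrightarrow> t < 1 \<longrightarrow>
        f ((1 - t) *\<^sub>R x + t *\<^sub>R y) < (1 - t) * f x + t * f y)"

definition tangent_cone :: "'a::euclidean_space set \<Rightarrow> 'a \<Rightarrow> 'a set" where
  "tangent_cone C x = closure {v. \<exists>s>0. x + s *\<^sub>R v \<in> C}"

definition normal_cone :: "'a::euclidean_space set \<Rightarrow> 'a \<Rightarrow> 'a set" where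
  "normal_cone C x = {\<eta>. \<forall>v \<in> tangent_cone C x. v \<bullet> \<eta> \<le> 0}"

definition tangent_proj :: "'a::euclidean_space set \<Rightarrow> 'a \<Rightarrow> 'a \<Rightarrow> 'a" where
  "tangent_proj C x v = arg_min_on (\<lambda>w. (norm (v - w))\<^sup>2) (tangent_cone C x)"

text \<open>
  The minimizer in \<open>tangent_proj\<close> exists and is unique whenever the set is convex and the
  base point lies in it, and it is then the library's metric projection.
\<close>

lemma convex_tangent_cone:
  assumes "convex C" "x \<in> C"
  shows "convex (tangent_cone C x)" and "0 \<in> tangent_cone C x"
proof -
  let ?K = "{v. \<exists>s>0. x + s *\<^sub>R v \<in> C}"
  have "convex ?K"
    unfolding convex_alt
  proof (intro ballI allI impI)
    fix v w :: 'a and u :: real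
    assume "v \<in> ?K" "w \<in> ?K" and u: "0 \<le> u \<and> u \<le> 1"
    then obtain s t where s: "s > 0" "x + s *\<^sub>R v \<in> C" and t: "t > 0" "x + t *\<^sub>R w \<in> C"
      by blast
    define r where "r = s * t / (s + t)"
    have scale: "x + a *\<^sub>R y \<in> C" if "x + b *\<^sub>R y \<in> C" "0 \<le> a" "a \<le> b" "b > 0" for a b y
    proof -
      have "(1 - a / b) *\<^sub>R x + (a / b) *\<^sub>R (x + b *\<^sub>R y) \<in> C"
        by (rule convexD_alt) (use assms that in auto)
      moreover have "(1 - a / b) *\<^sub>R x + (a / b) *\<^sub>R (x + b *\<^sub>R y) = x + a *\<^sub>R y"
        using that by (simp add: algebra_simps)
      ultimately show ?thesis by simp
    qed
    have r: "0 < r" "r \<le> s" "r \<le> t"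
    proof -
      show "0 < r" using s t by (simp add: r_def)
      have "s * t \<le> s * (s + t)" "s * t \<le> t * (s + t)"
        using s t by (auto simp: distrib_left)
      then show "r \<le> s" "r \<le> t"
        using s t by (auto simp: r_def pos_divide_le_eq)
    qed
    have "(1 - u) *\<^sub>R (x + r *\<^sub>R v) + u *\<^sub>R (x + r *\<^sub>R w) \<in> C"
      by (rule convexD_alt) (use assms(1) u scale[OF s(2), of r] scale[OF t(2), of r] r s t in auto)
    moreover have "(1 - u) *\<^sub>R (x + r *\<^sub>R v) + u *\<^sub>R (x + r *\<^sub>R w)
        = x + r *\<^sub>R ((1 - u) *\<^sub>R v + u *\<^sub>R w)"
      by (simp add: algebra_simps)
    ultimately show "(1 - u) *\<^sub>R v + u *\<^sub>R w \<in> ?K"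
      using r by auto
  qed
  then show "convex (tangent_cone C x)"
    unfolding tangent_cone_def by (rule convex_closure)
  have "0 \<in> ?K" using assms by (auto intro: exI[of _ 1])
  then show "0 \<in> tangent_cone C x"
    unfolding tangent_cone_def by (rule subsetD[OF closure_subset])
qed

lemma tangent_proj_eq_closest_point:
  assumes "convex C" "x \<in> C"
  shows "tangent_proj C x v = closest_point (tangent_cone C x) v"
proof -
  let ?T = "tangent_cone C x"
  have cl: "closed ?T" by (simp add: tangent_cone_def)
  have ne: "?T \<noteq> {}" using convex_tangent_cone[OF assms] by auto
  have sq: "(norm (v - a))\<^sup>2 < (norm (v - b))\<^sup>2 \<longleftrightarrow> dist v a < dist v b" for a b
    by (smt (verit, best) dist_norm norm_ge_zero power_less_imp_less_base power_strict_mono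
        zero_less_numeral)
  have "is_arg_min (\<lambda>w. (norm (v - w))\<^sup>2) (\<lambda>w. w \<in> ?T) = (\<lambda>w. w \<in> ?T \<and> (\<forall>y\<in>?T. dist v w \<le> dist v y))"
    by (auto simp: is_arg_min_def sq fun_eq_iff not_less)
  then show ?thesis
    unfolding tangent_proj_def arg_min_on_def arg_min_def closest_point_def by simp
qed


section \<open>Gradients\<close>

definition gradient :: "('a::real_inner \<Rightarrow> real) \<Rightarrow> 'a \<Rightarrow> 'a" where
  "gradient f x = (THE D. GDERIV f x :> D)"

text \<open>The \<open>n \<times> m\<close> matrix whose columns are the gradients of the components of \<open>g\<close>, i.e. the
  transpose of the Jacobian.\<close>

definition gradient_matrix :: "(real^'n \<Rightarrow> real^'m) \<Rightarrow> real^'n \<Rightarrow> real^'m^'n" where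
  "gradient_matrix g x = (\<chi> j i. gradient (\<lambda>y. g y $ i) x $ j)"

lemma gradientI:
  assumes "GDERIV f x :> D"
  shows "gradient f x = D"
  unfolding gradient_def
proof (rule the_equality)
  fix E assume "GDERIV f x :> E"
  then have "(\<lambda>h. h \<bullet> E) = (\<lambda>h. h \<bullet> D)"
    using assms has_derivative_unique unfolding gderiv_def by blast
  then show "E = D"
    by (simp only: fun_eq_iff vector_eq_ldot)
qed (rule assms)

lemma GDERIV_gradient:
  fixes f :: "'a::euclidean_space \<Rightarrow> real"
  assumes "f differentiable (at x)"
  shows "GDERIV f x :> gradient f x"
proof -
  obtain f' where f': "(f has_derivative f') (at x)"
    using assms by (auto simp: differentiable_def)
  then have "linear f'"
    using has_derivative_linear by blast
  then have "f' = (\<lambda>h. h \<bullet> adjoint f' 1)"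
    by (auto simp: adjoint_works fun_eq_iff)
  then have "GDERIV f x :> adjoint f' 1"
    using f' by (simp add: gderiv_def)
  then show ?thesis
    using gradientI by metis
qed


section \<open>Primal-dual solutions and the augmented primal-dual vector field\<close>

definition pd_solution ::
  "(real^'n) set \<Rightarrow> (real^'n \<Rightarrow> real) \<Rightarrow> (real^'n \<Rightarrow> real^'m) \<Rightarrow> (real^'n) \<times> (real^'m) \<Rightarrow> bool" where
  "pd_solution X f g = (\<lambda>(x, \<mu>). x \<in> X \<and> g x \<le> 0 \<and> 0 \<le> \<mu> \<and>
     gradient f x + gradient_matrix g x *v \<mu> \<in> uminus ` normal_cone X x \<and>
     (\<forall>i. 0 < \<mu> $ i \<longrightarrow> g x $ i = 0))"

definition pd_domain :: "(real^'n) set \<Rightarrow> ((real^'n) \<times> (real^'m)) set" where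
  "pd_domain X = X \<times> {\<mu>. 0 \<le> \<mu>}"

definition pos_part :: "real^'m \<Rightarrow> real^'m" where
  "pos_part v = (\<chi> i. max 0 (v $ i))"

definition aug_lagrangian ::
  "(real^'n \<Rightarrow> real) \<Rightarrow> (real^'n \<Rightarrow> real^'m) \<Rightarrow> real \<Rightarrow> real^'n \<Rightarrow> real^'m \<Rightarrow> real" where
  "aug_lagrangian f g \<rho> x \<mu> = f x + \<mu> \<bullet> g x + \<rho> / 2 * (norm (pos_part (g x)))\<^sup>2"

definition pd_field ::
  "(real^'n \<Rightarrow> real) \<Rightarrow> (real^'n \<Rightarrow> real^'m) \<Rightarrow> real \<Rightarrow> (real^'n) \<times> (real^'m) \<Rightarrow> (real^'n) \<times> (real^'m)" where
  "pd_field f g \<rho> = (\<lambda>(x, \<mu>).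
     (- gradient (\<lambda>y. aug_lagrangian f g \<rho> y \<mu>) x, gradient (\<lambda>\<nu>. aug_lagrangian f g \<rho> x \<nu>) \<mu>))"

lemma DERIV_max0_sq: "((\<lambda>t::real. (max 0 t)\<^sup>2) has_real_derivative 2 * max 0 t) (at t)"
proof -
  consider "t > 0" | "t < 0" | "t = 0" by linarith
  then show ?thesis
  proof cases
    case 1
    have "((\<lambda>t::real. t\<^sup>2) has_real_derivative 2 * max 0 t) (at t)"
      using 1 by (auto intro!: derivative_eq_intros)
    then show ?thesis
      by (rule has_field_derivative_transform_within_open[where S = "{0<..}"]) (use 1 in auto)
  next
    case 2
    have "((\<lambda>t::real. 0) has_real_derivative 2 * max 0 t) (at t)"
      using 2 by (auto intro!: derivative_eq_intros)
    then show ?thesis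
      by (rule has_field_derivative_transform_within_open[where S = "{..<0}"]) (use 2 in auto)
  next
    case 3
    have "((\<lambda>h::real. (max 0 h)\<^sup>2 / h) \<longlongrightarrow> 0) (at 0)"
    proof (rule Lim_null_comparison)
      show "\<forall>\<^sub>F h::real in at 0. norm ((max 0 h)\<^sup>2 / h) \<le> \<bar>h\<bar>"
        by (rule always_eventually) (auto simp: max_def power2_eq_square)
      show "((\<lambda>h::real. \<bar>h\<bar>) \<longlongrightarrow> 0) (at 0)"
        by (intro tendsto_eq_intros) auto
    qed
    then show ?thesis
      using 3 by (simp add: DERIV_def)
  qed
qed

lemma pd_field_explicit:
  fixes f :: "real^'n \<Rightarrow> real" and g :: "real^'n \<Rightarrow> real^'m"
  assumes f: "f differentiable (at x)" and g: "g differentiable (at x)"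
  shows "pd_field f g \<rho> (x, \<mu>) =
     (- gradient f x - gradient_matrix g x *v (\<mu> + \<rho> *\<^sub>R pos_part (g x)), g x)"
proof -
  have gi: "(\<lambda>y. g y $ i) differentiable (at x)" for i
    using g unfolding differentiable_def
    by (blast intro: bounded_linear.has_derivative[OF bounded_linear_vec_nth])
  let ?G = "\<lambda>i. gradient (\<lambda>y. g y $ i) x"
  have Dg: "((\<lambda>y. g y $ i) has_derivative (\<lambda>h. h \<bullet> ?G i)) (at x)" for i
    using GDERIV_gradient[OF gi] by (simp add: gderiv_def)
  have Df: "(f has_derivative (\<lambda>h. h \<bullet> gradient f x)) (at x)"
    using GDERIV_gradient[OF f] by (simp add: gderiv_def)
  have sq: "((\<lambda>y. (max 0 (g y $ i))\<^sup>2) has_derivative (\<lambda>h. (2 * max 0 (g x $ i)) * (h \<bullet> ?G i))) (at x)" for i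
    using has_derivative_compose[OF Dg, of "\<lambda>t. (max 0 t)\<^sup>2" "(*) (2 * max 0 (g x $ i))" i]
      DERIV_max0_sq[of "g x $ i"] by (auto simp: has_field_derivative_def)
  have L: "aug_lagrangian f g \<rho> y \<nu> =
      f y + (\<Sum>i\<in>UNIV. \<nu> $ i * g y $ i) + \<rho> / 2 * (\<Sum>i\<in>UNIV. (max 0 (g y $ i))\<^sup>2)" for y \<nu>
    by (simp only: aug_lagrangian_def power2_norm_eq_inner)
       (simp add: inner_vec_def pos_part_def power2_eq_square)
  have col: "(h v* gradient_matrix g x) $ i = h \<bullet> ?G i" for h i
    by (simp add: vector_matrix_mult_def gradient_matrix_def inner_vec_def mult.commute)
  have mv: "h \<bullet> (gradient_matrix g x *v w) = (\<Sum>i\<in>UNIV. w $ i * (h \<bullet> ?G i))" for h w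
  proof -
    have "h \<bullet> (gradient_matrix g x *v w) = (\<Sum>i\<in>UNIV. (h v* gradient_matrix g x) $ i * w $ i)"
      unfolding dot_lmul_matrix[symmetric] by (simp only: inner_vec_def inner_real_def)
    then show ?thesis
      by (simp only: col mult.commute)
  qed
  have "((\<lambda>y. aug_lagrangian f g \<rho> y \<mu>) has_derivative
      (\<lambda>h. h \<bullet> gradient f x + (\<Sum>i\<in>UNIV. \<mu> $ i * (h \<bullet> ?G i))
         + \<rho> / 2 * (\<Sum>i\<in>UNIV. (2 * max 0 (g x $ i)) * (h \<bullet> ?G i)))) (at x)"
    unfolding L
    by (intro has_derivative_add has_derivative_sum has_derivative_mult_right Df Dg sq)
  also have "(\<lambda>h. h \<bullet> gradient f x + (\<Sum>i\<in>UNIV. \<mu> $ i * (h \<bullet> ?G i))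
         + \<rho> / 2 * (\<Sum>i\<in>UNIV. (2 * max 0 (g x $ i)) * (h \<bullet> ?G i)))
     = (\<lambda>h. h \<bullet> (gradient f x + gradient_matrix g x *v (\<mu> + \<rho> *\<^sub>R pos_part (g x))))"
    by (simp add: inner_add_right mv pos_part_def sum_distrib_left distrib_right sum.distrib mult.assoc add.assoc)
  finally have x: "gradient (\<lambda>y. aug_lagrangian f g \<rho> y \<mu>) x =
      gradient f x + gradient_matrix g x *v (\<mu> + \<rho> *\<^sub>R pos_part (g x))"
    by (intro gradientI) (simp add: gderiv_def)
  have "gradient (\<lambda>\<nu>. aug_lagrangian f g \<rho> x \<nu>) \<mu> = g x"
    by (intro gradientI)
       (auto simp: gderiv_def aug_lagrangian_def intro!: derivative_eq_intros)
  with x show ?thesis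
    by (simp add: pd_field_def)
qed


section \<open>The zero-dissipation set\<close>

definition zero_dissipation_points ::
  "(real^'n) set \<Rightarrow> (real^'n \<Rightarrow> real) \<Rightarrow> (real^'n \<Rightarrow> real^'m) \<Rightarrow> real \<Rightarrow>
   (real^'n) \<times> (real^'m) \<Rightarrow> ((real^'n) \<times> (real^'m)) set" where
  "zero_dissipation_points X f g \<rho> zs =
     {z \<in> pd_domain X. (z - zs) \<bullet> tangent_proj (pd_domain X) z (pd_field f g \<rho> z) = 0}"

definition zero_dissipation_set ::
  "(real^'n) set \<Rightarrow> (real^'n \<Rightarrow> real) \<Rightarrow> (real^'n \<Rightarrow> real^'m) \<Rightarrow> real \<Rightarrow>
   (real^'n) \<times> (real^'m) \<Rightarrow> ((real^'n) \<times> (real^'m)) set" where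
  "zero_dissipation_set X f g \<rho> zs = closure (zero_dissipation_points X f g \<rho> zs)"

text \<open>
  Passing to the closure does not affect the closed conditions, but it destroys the implication
  \<open>g i x* = 0 \<Longrightarrow> \<mu> i > 0 \<or> g i x \<ge> 0\<close> that strict complementarity yields at points of zero dissipation,
  since \<open>\<mu> i > 0\<close> is not a closed condition.  For the linear program of minimizing \<open>x\<close> subject to
  \<open>-x \<le> 0\<close> over the real line, whose unique primal-dual solution \<open>(0, 1)\<close> is strictly complementary,
  every \<open>(x, \<mu>)\<close> with \<open>x \<ge> 0\<close> and \<open>\<mu> > 0\<close> has zero dissipation, so \<open>(1, 0)\<close> lies in the closure.
  Hence that implication can only be claimed on \<open>zero_dissipation_points\<close>.
\<close>

lemma strict_complementarity_fails_on_closure: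
  fixes f :: "real^1 \<Rightarrow> real" and g :: "real^1 \<Rightarrow> real^1"
  defines "f \<equiv> \<lambda>x. x $ 1" and "g \<equiv> \<lambda>x. - x"
  shows "convex_on UNIV f" and "\<forall>i. convex_on UNIV (\<lambda>x. g x $ i)"
    and "\<forall>x. f differentiable (at x)" and "\<forall>x. g differentiable (at x)"
    and "\<exists>x\<in>UNIV. g x \<le> 0 \<and> (\<forall>y\<in>UNIV. g y \<le> 0 \<longrightarrow> f x \<le> f y)"
    and "rel_interior {x \<in> UNIV. g x \<le> 0} \<noteq> {}"
    and "pd_solution UNIV f g (0, 1)"
    and "\<forall>i. g 0 $ i = 0 \<longrightarrow> 0 < (1::real^1) $ i"
    and "(1, 0) \<in> zero_dissipation_set UNIV f g \<rho> (0, 1)"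
    and "g 0 $ 1 = 0" and "\<not> (0 < (0::real^1) $ 1 \<or> 0 \<le> g 1 $ 1)"
proof -
  note defs = f_def g_def
  have all1: "(\<forall>i::1. P i) \<longleftrightarrow> P 1" for P
    by (metis num1_eq1)
  have lin: "linear f" "linear g"
    by (auto simp: defs intro!: linearI)
  show df: "\<forall>x. f differentiable (at x)" and dg: "\<forall>x. g differentiable (at x)"
    using lin linear_imp_differentiable by blast+
  show "convex_on UNIV f" "\<forall>i. convex_on UNIV (\<lambda>x. g x $ i)"
    by (auto simp: defs convex_on_def algebra_simps)
  show "\<exists>x\<in>UNIV. g x \<le> 0 \<and> (\<forall>y\<in>UNIV. g y \<le> 0 \<longrightarrow> f x \<le> f y)"
    by (rule bexI[of _ 0]) (auto simp: defs less_eq_vec_def)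
  have "convex {x \<in> UNIV. g x \<le> 0}"
    by (auto simp: defs less_eq_vec_def convex_def all1)
  moreover have "0 \<in> {x \<in> UNIV. g x \<le> 0}" by (simp add: defs)
  ultimately show "rel_interior {x \<in> UNIV. g x \<le> 0} \<noteq> {}"
    using rel_interior_eq_empty by blast
  have Gf: "gradient f x = 1" for x
    by (intro gradientI)
       (auto simp: gderiv_def defs inner_vec_def
          intro!: bounded_linear.has_derivative[OF bounded_linear_vec_nth] derivative_eq_intros)
  have Gg: "gradient (\<lambda>y. g y $ i) x = -1" for i x
  proof -
    have "gradient (\<lambda>y. g y $ 1) x = -1"
      by (intro gradientI)
         (auto simp: gderiv_def defs inner_vec_def intro!: has_derivative_minus
            bounded_linear.has_derivative[OF bounded_linear_vec_nth] derivative_eq_intros)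
    then show ?thesis
      by (metis num1_eq1)
  qed
  have Gm: "gradient_matrix g x *v \<mu> = - \<mu>" for x \<mu>
    by (simp add: gradient_matrix_def Gg matrix_vector_mult_def vec_eq_iff all1)
  have "0 \<in> uminus ` normal_cone UNIV (0::real^1)"
    by (rule image_eqI[of _ _ 0]) (simp_all add: normal_cone_def)
  moreover have "g 0 = 0" by (simp add: defs)
  ultimately show "pd_solution UNIV f g (0, 1)"
    by (simp add: pd_solution_def Gf Gm less_eq_vec_def)
  show "\<forall>i. g 0 $ i = 0 \<longrightarrow> 0 < (1::real^1) $ i" by simp
  show "g 0 $ 1 = 0" "\<not> (0 < (0::real^1) $ 1 \<or> 0 \<le> g 1 $ 1)" by (simp_all add: defs)
  have pts: "(1, vec t) \<in> zero_dissipation_points UNIV f g \<rho> (0, 1)" if t: "t > 0" for t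
  proof -
    let ?Z = "pd_domain UNIV :: ((real^1) \<times> (real^1)) set"
    let ?z = "(1, vec t) :: (real^1) \<times> (real^1)"
    have mem: "?z \<in> ?Z" using t by (simp add: pd_domain_def less_eq_vec_def)
    have "convex ?Z"
      unfolding pd_domain_def
      by (intro convex_Times) (auto simp: convex_def less_eq_vec_def)
    moreover have "tangent_cone ?Z ?z = UNIV"
    proof -
      have "\<exists>s>0. ?z + s *\<^sub>R v \<in> ?Z" for v :: "(real^1) \<times> (real^1)"
      proof (intro exI conjI)
        let ?s = "t / (1 + \<bar>snd v $ 1\<bar>)"
        show "?s > 0" using t by simp
        have "- (?s * snd v $ 1) \<le> ?s * (1 + \<bar>snd v $ 1\<bar>)"
          unfolding mult_minus_right[symmetric] using \<open>?s > 0\<close> by (intro mult_left_mono) auto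
        also have "\<dots> = t" by (simp add: add_pos_nonneg less_imp_neq[symmetric])
        finally show "?z + ?s *\<^sub>R v \<in> ?Z"
          by (cases v) (auto simp: pd_domain_def less_eq_vec_def all1)
      qed
      then show ?thesis by (simp add: tangent_cone_def)
    qed
    ultimately have "tangent_proj ?Z ?z v = v" for v
      using mem by (simp add: tangent_proj_eq_closest_point closest_point_self)
    moreover have "pos_part (g 1) = 0"
      by (simp add: pos_part_def defs vec_eq_iff)
    then have "pd_field f g \<rho> ?z = (vec t - 1, -1)"
      using df dg by (simp add: pd_field_explicit Gf Gm) (simp add: defs)
    ultimately show ?thesis
      using mem by (simp add: zero_dissipation_points_def inner_vec_def)
  qed
  show "(1, 0) \<in> zero_dissipation_set UNIV f g \<rho> (0, 1)"
    unfolding zero_dissipation_set_def closure_approachable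
  proof (intro allI impI)
    fix e :: real assume e: "e > 0"
    have "dist (1 :: real^1, vec (e / 2) :: real^1) (1, 0) < e"
      using e by (simp add: dist_Pair_Pair dist_norm norm_vec_def L2_set_def)
    then show "\<exists>y\<in>zero_dissipation_points UNIV f g \<rho> (0, 1). dist y (1, 0) < e"
      using pts[of "e / 2"] e by force
  qed
qed

end

theory Submission
  imports Defs
begin

text \<open>
  The residual of the projection onto the tangent cone is a normal vector, so projecting the field
  can only increase the dissipation; hence zero dissipation of the projected field forces zero
  dissipation of the field itself and orthogonality of the residual to \<open>z - zs\<close>.  The former makes
  all the gradient inequalities involved tight, and a convex differentiable function that touches
  its tangent at another point has the same gradient at both points.  The latter yields the claim
  under strict complementarity.
\<close>

section \<open>Convex functions and their tangents\<close>

text \<open>Restricting \<open>f\<close> to the line through \<open>x\<close> and \<open>y\<close>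
  reduces the claim to the tangent inequality for convex functions of one real variable, taken
  between the parameters 0 and 1.\<close>

lemma GDERIV_convex_above_tangent:
  fixes f :: "'a::real_inner \<Rightarrow> real"
  assumes "convex_on UNIV f" "GDERIV f x :> D"
  shows "f x + (y - x) \<bullet> D \<le> f y"
proof -
  let ?\<phi> = "\<lambda>t. f (x + t *\<^sub>R (y - x))"
  have "convex_on UNIV ?\<phi>"
  proof (rule convex_onI)
    fix t a b :: real assume "0 < t" "t < 1"
    have "x + ((1 - t) *\<^sub>R a + t *\<^sub>R b) *\<^sub>R (y - x)
        = (1 - t) *\<^sub>R (x + a *\<^sub>R (y - x)) + t *\<^sub>R (x + b *\<^sub>R (y - x))"
      by (simp add: algebra_simps)
    then show "?\<phi> ((1 - t) *\<^sub>R a + t *\<^sub>R b) \<le> (1 - t) * ?\<phi> a + t * ?\<phi> b"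
      using convex_onD[OF assms(1)] \<open>0 < t\<close> \<open>t < 1\<close> by simp
  qed simp
  moreover have "(?\<phi> has_field_derivative (y - x) \<bullet> D) (at 0)"
  proof -
    have "((\<lambda>t. x + t *\<^sub>R (y - x)) has_derivative (\<lambda>t. t *\<^sub>R (y - x))) (at 0)"
      by (auto intro!: derivative_eq_intros)
    from has_derivative_compose[OF this, of f "\<lambda>h. h \<bullet> D"] assms(2)
    have "(?\<phi> has_derivative (\<lambda>t. (t *\<^sub>R (y - x)) \<bullet> D)) (at 0)"
      by (simp add: gderiv_def)
    moreover have "(\<lambda>t. (t *\<^sub>R (y - x)) \<bullet> D) = (*) ((y - x) \<bullet> D)"
      by (simp add: fun_eq_iff mult.commute)
    ultimately show ?thesis
      by (simp add: has_field_derivative_def)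
  qed
  ultimately have "?\<phi> 1 - ?\<phi> 0 \<ge> (y - x) \<bullet> D * (1 - 0)"
    by (intro convex_on_imp_above_tangent[where A = UNIV]) auto
  then show ?thesis by simp
qed

lemma convex_above_gradient:
  fixes f :: "'a::euclidean_space \<Rightarrow> real"
  assumes "convex_on UNIV f" "f differentiable (at x)"
  shows "f x + (y - x) \<bullet> gradient f x \<le> f y"
  using GDERIV_convex_above_tangent[OF assms(1) GDERIV_gradient[OF assms(2)]] .

text \<open>After subtracting the linear functional given by the gradient at \<open>y\<close>, the
  tangent inequality makes \<open>y\<close> a global minimizer. Touching gives \<open>x\<close> the
  same value, so \<open>x\<close> is a minimizer too and the derivative vanishes there.\<close>

lemma gradient_eq_if_touches_tangent:
  fixes f :: "'a::euclidean_space \<Rightarrow> real"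
  assumes "convex_on UNIV f" "\<And>x. f differentiable (at x)"
    and touch: "f x = f y + (x - y) \<bullet> gradient f y"
  shows "gradient f x = gradient f y"
proof -
  let ?h = "\<lambda>v. f v - v \<bullet> gradient f y"
  have "(?h has_derivative (\<lambda>v. v \<bullet> gradient f x - v \<bullet> gradient f y)) (at x)"
    using GDERIV_gradient[OF assms(2), of x] unfolding gderiv_def
    by (auto intro!: derivative_eq_intros)
  moreover have "?h x \<le> ?h v" for v
    using convex_above_gradient[OF assms(1,2), of y v] touch by (simp add: inner_diff_left)
  ultimately have "(\<lambda>v. v \<bullet> gradient f x - v \<bullet> gradient f y) = (\<lambda>v. 0)"
    by (intro has_derivative_local_min) (auto intro: always_eventually)
  then show ?thesis
    by (simp add: fun_eq_iff vector_eq_ldot)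
qed

text \<open>If the points differed, the chord between them would lie on the tangent, and strict
  convexity would put the value at the midpoint strictly below that tangent.\<close>

lemma strictly_convex_touches_tangent:
  fixes f :: "'a::euclidean_space \<Rightarrow> real"
  assumes strict: "strictly_convex_on UNIV f" and conv: "convex_on UNIV f"
    and diff: "f differentiable (at y)"
    and touch: "f x = f y + (x - y) \<bullet> gradient f y"
  shows "x = y"
proof (rule ccontr)
  assume "x \<noteq> y"
  define m where "m = (1 - 1/2) *\<^sub>R x + (1/2) *\<^sub>R y"
  have "f m < (1 - 1/2) * f x + 1/2 * f y"
    using strict \<open>x \<noteq> y\<close> unfolding strictly_convex_on_def m_def
    by (metis UNIV_I half_gt_zero_iff field_sum_of_halves less_add_same_cancel1 zero_less_one)
  then have "2 * f m < f x + f y"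
    by (simp add: field_simps)
  moreover have m: "m - y = (1/2) *\<^sub>R (x - y)"
    by (simp add: m_def algebra_simps flip: scaleR_add_left)
  have "2 * f y + (x - y) \<bullet> gradient f y \<le> 2 * f m"
    using convex_above_gradient[OF conv diff, of m] by (simp add: m)
  ultimately show False
    using touch by linarith
qed

section \<open>Tangent cones and the residual of the projection\<close>

lemma cone_tangent_cone:
  assumes "convex C" "x \<in> C"
  shows "cone (tangent_cone C x)"
proof -
  have "cone {v. \<exists>s>0. x + s *\<^sub>R v \<in> C}"
    unfolding cone_def
  proof (intro ballI allI impI, clarify)
    fix v c s assume "(0::real) \<le> c" "0 < s" "x + s *\<^sub>R v \<in> C"
    then show "\<exists>s>0. x + s *\<^sub>R c *\<^sub>R v \<in> C"
      using \<open>x \<in> C\<close> by (cases "c = 0") (auto intro: exI[of _ 1] exI[of _ "s / c"])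
  qed
  then show ?thesis
    unfolding tangent_cone_def by (rule cone_closure)
qed

lemma diff_mem_tangent_cone:
  assumes "x + v \<in> C"
  shows "v \<in> tangent_cone C x"
proof -
  have "v \<in> {v. \<exists>s>0. x + s *\<^sub>R v \<in> C}"
    using assms by (auto intro: exI[of _ 1])
  then show ?thesis
    unfolding tangent_cone_def by (rule subsetD[OF closure_subset])
qed

lemma tangent_proj_mem:
  assumes "convex C" "x \<in> C"
  shows "tangent_proj C x v \<in> tangent_cone C x"
proof -
  have "closed (tangent_cone C x)" "tangent_cone C x \<noteq> {}"
    using convex_tangent_cone(2)[OF assms] by (simp add: tangent_cone_def, blast)
  then show ?thesis
    unfolding tangent_proj_eq_closest_point[OF assms] by (rule closest_point_in_set)
qed

text \<open>The variational inequality of the closest point \<open>?p\<close> is tested at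
  \<open>?p + w\<close>, which stays in the tangent cone because a convex cone is closed under
  addition.\<close>

lemma tangent_proj_residual:
  assumes "convex C" "x \<in> C" and w: "w \<in> tangent_cone C x"
  shows "w \<bullet> (v - tangent_proj C x v) \<le> 0"
proof -
  let ?T = "tangent_cone C x" and ?p = "tangent_proj C x v"
  have p: "?p + w \<in> ?T"
    using tangent_proj_mem[OF assms(1,2)] w cone_tangent_cone[OF assms(1,2)]
      convex_tangent_cone(1)[OF assms(1,2)] convex_cone by blast
  have "closed ?T"
    by (simp add: tangent_cone_def)
  then have "(v - ?p) \<bullet> (?p + w - ?p) \<le> 0"
    unfolding tangent_proj_eq_closest_point[OF assms(1,2)]
    using convex_tangent_cone(1)[OF assms(1,2)]
      p[unfolded tangent_proj_eq_closest_point[OF assms(1,2)]]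
    by (intro closest_point_dot)
  then show ?thesis
    by (simp add: inner_commute)
qed

lemma inner_gradient_matrix:
  "h \<bullet> (gradient_matrix g x *v w) = (\<Sum>i\<in>UNIV. w $ i * (h \<bullet> gradient (\<lambda>y. g y $ i) x))"
proof -
  have "h \<bullet> (gradient_matrix g x *v w) = (\<Sum>i\<in>UNIV. (h v* gradient_matrix g x) $ i * w $ i)"
    unfolding dot_lmul_matrix[symmetric] by (simp only: inner_vec_def inner_real_def)
  then show ?thesis
    by (simp add: vector_matrix_mult_def gradient_matrix_def inner_vec_def mult.commute)
qed

lemma convex_pd_domain: "convex X \<Longrightarrow> convex (pd_domain X)"
  unfolding pd_domain_def
  by (intro convex_Times) (auto simp: convex_def less_eq_vec_def)

lemma closed_pd_domain: "closed X \<Longrightarrow> closed (pd_domain X)"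
  unfolding pd_domain_def less_eq_vec_def
  by (intro closed_Times closed_Collect_all closed_Collect_le continuous_intros)

section \<open>Gaps and dissipation of the unprojected field\<close>

locale convex_program =
  fixes f :: "real^'n \<Rightarrow> real" and g :: "real^'n \<Rightarrow> real^'m" and X :: "(real^'n) set"
    and \<rho> :: real and xs :: "real^'n" and \<mu>s :: "real^'m"
  assumes convex_f: "convex_on UNIV f"
    and convex_g: "\<And>i. convex_on UNIV (\<lambda>x. g x $ i)"
    and diff_f: "\<And>x. f differentiable (at x)"
    and diff_g: "\<And>x. g differentiable (at x)"
    and closed_X: "closed X" and convex_X: "convex X"
    and rho_nonneg: "0 \<le> \<rho>"
    and solution: "pd_solution X f g (xs, \<mu>s)"
begin

abbreviation grad_g :: "'m \<Rightarrow> real^'n \<Rightarrow> real^'n" where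
  "grad_g i x \<equiv> gradient (\<lambda>y. g y $ i) x"

text \<open>This is the Bregman divergence of \<open>f\<close> with the base point as first
  argument. It vanishes exactly when the tangent at \<open>x\<close> meets the graph at
  \<open>y\<close>.\<close>

definition gap_f :: "real^'n \<Rightarrow> real^'n \<Rightarrow> real" where
  "gap_f x y = f y - f x - (y - x) \<bullet> gradient f x"

definition gap_g :: "'m \<Rightarrow> real^'n \<Rightarrow> real^'n \<Rightarrow> real" where
  "gap_g i x y = g y $ i - g x $ i - (y - x) \<bullet> grad_g i x"

lemma diff_gi: "(\<lambda>y. g y $ i) differentiable (at x)"
  using diff_g[of x] unfolding differentiable_def
  by (blast intro: bounded_linear.has_derivative[OF bounded_linear_vec_nth])

lemma gap_nonneg: "0 \<le> gap_f x y" "0 \<le> gap_g i x y"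
  using convex_above_gradient[OF convex_f diff_f, of x y]
    convex_above_gradient[OF convex_g[of i] diff_gi, of x y]
  by (simp_all add: gap_f_def gap_g_def)

lemma gap_f_eq_0D: "gap_f x y = 0 \<Longrightarrow> gradient f y = gradient f x"
  using gradient_eq_if_touches_tangent[OF convex_f diff_f, of y x] by (simp add: gap_f_def)

lemma gap_g_eq_0D: "gap_g i x y = 0 \<Longrightarrow> grad_g i y = grad_g i x"
  using gradient_eq_if_touches_tangent[OF convex_g[of i] diff_gi, of y x] by (simp add: gap_g_def)

lemma solution_mem: "xs \<in> X" "(xs, \<mu>s) \<in> pd_domain X"
  and solution_feasible: "g xs \<le> 0" "g xs $ i \<le> 0"
  and solution_mult: "0 \<le> \<mu>s $ i"
  and complementary: "\<mu>s $ i * g xs $ i = 0"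
  using solution by (auto simp: pd_solution_def pd_domain_def less_eq_vec_def dual_order.antisym
      order_less_le)

text \<open>The displacement \<open>x - xs\<close> is a tangent direction at \<open>xs\<close>, and
  the gradient of the Lagrangian there is minus a normal vector.\<close>

lemma stationarity:
  assumes "x \<in> X"
  shows "0 \<le> (x - xs) \<bullet> gradient f xs + (\<Sum>i\<in>UNIV. \<mu>s $ i * ((x - xs) \<bullet> grad_g i xs))"
proof -
  obtain \<eta> where \<eta>: "\<eta> \<in> normal_cone X xs" "gradient f xs + gradient_matrix g xs *v \<mu>s = - \<eta>"
    using solution by (auto simp: pd_solution_def)
  have "x - xs \<in> tangent_cone X xs"
    by (rule diff_mem_tangent_cone) (simp add: assms)
  then have "(x - xs) \<bullet> \<eta> \<le> 0"
    using \<eta>(1) by (auto simp: normal_cone_def)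
  then have "0 \<le> (x - xs) \<bullet> (gradient f xs + gradient_matrix g xs *v \<mu>s)"
    by (simp add: \<eta>(2))
  then show ?thesis
    by (simp add: inner_add_right inner_gradient_matrix)
qed

text \<open>Every term on the right is nonnegative, so zero dissipation forces each of them to vanish.\<close>

lemma dissipation_identity:
  "- (((x, \<mu>) - (xs, \<mu>s)) \<bullet> pd_field f g \<rho> (x, \<mu>)) =
     gap_f x xs + gap_f xs x
     + ((x - xs) \<bullet> gradient f xs + (\<Sum>i\<in>UNIV. \<mu>s $ i * ((x - xs) \<bullet> grad_g i xs)))
     + (\<Sum>i\<in>UNIV. \<mu> $ i * gap_g i x xs) + (\<Sum>i\<in>UNIV. \<mu>s $ i * gap_g i xs x)
     + (\<Sum>i\<in>UNIV. \<mu> $ i * - g xs $ i)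
     + (\<Sum>i\<in>UNIV. \<rho> * max 0 (g x $ i) * (g x $ i + gap_g i x xs - g xs $ i))"
proof -
  have c: "g xs $ i * \<mu>s $ i = 0" for i
    using complementary[of i] by (simp add: mult.commute)
  \<comment> \<open>The slope at \<open>x\<close> is rewritten through \<open>gap_g i x xs\<close>,
    and \<open>g x $ i\<close> in the \<open>\<mu>s\<close> term is expanded around
    \<open>xs\<close>. Complementarity removes the leftover product of \<open>\<mu>s $ i\<close> and
    \<open>g xs $ i\<close>.\<close>
  have sum: "\<mu> $ i * ((x - xs) \<bullet> grad_g i x) + \<rho> * max 0 (g x $ i) * ((x - xs) \<bullet> grad_g i x)
      - (\<mu> $ i - \<mu>s $ i) * g x $ i =
     \<mu>s $ i * ((x - xs) \<bullet> grad_g i xs) + \<mu> $ i * gap_g i x xs + \<mu>s $ i * gap_g i xs x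
     + \<mu> $ i * - g xs $ i + \<rho> * max 0 (g x $ i) * (g x $ i + gap_g i x xs - g xs $ i)" for i
    using c[of i] unfolding gap_g_def inner_diff_left by (simp add: algebra_simps)
  have "- (((x, \<mu>) - (xs, \<mu>s)) \<bullet> pd_field f g \<rho> (x, \<mu>)) = (x - xs) \<bullet> gradient f x
     + (\<Sum>i\<in>UNIV. \<mu> $ i * ((x - xs) \<bullet> grad_g i x) + \<rho> * max 0 (g x $ i) * ((x - xs) \<bullet> grad_g i x)
      - (\<mu> $ i - \<mu>s $ i) * g x $ i)"
    unfolding pd_field_explicit[OF diff_f diff_g]
    by (simp add: inner_diff_right inner_gradient_matrix pos_part_def sum.distrib sum_subtractf
        distrib_right) (simp add: inner_vec_def sum_subtractf left_diff_distrib)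
  \<comment> \<open>In the sum of the two gaps the function values cancel, leaving the difference of
    the gradients paired with \<open>x - xs\<close>.\<close>
  also have "(x - xs) \<bullet> gradient f x = gap_f x xs + gap_f xs x + (x - xs) \<bullet> gradient f xs"
    by (simp add: gap_f_def inner_diff_left)
  finally show ?thesis
    unfolding sum by (simp add: sum.distrib sum_subtractf sum_negf)
qed

text \<open>Both sides vanish where the constraint holds. Where it is violated, the gap and
  \<open>- g xs $ i\<close> are nonnegative and only enlarge the factor \<open>g x $ i\<close>. Thus
  a vanishing augmentation term forces the penalty to vanish.\<close>

lemma augmentation_nonneg:
  "\<rho> * (max 0 (g x $ i))\<^sup>2 \<le> \<rho> * max 0 (g x $ i) * (g x $ i + gap_g i x xs - g xs $ i)"
proof -
  have "max 0 (g x $ i) * max 0 (g x $ i)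
      \<le> max 0 (g x $ i) * (g x $ i + gap_g i x xs - g xs $ i)"
    using gap_nonneg(2)[of i x xs] solution_feasible(2)[of i]
    by (cases "g x $ i \<le> 0") (auto intro!: mult_left_mono)
  then show ?thesis
    using rho_nonneg by (simp add: power2_eq_square mult.assoc mult_left_mono)
qed

lemma dissipation_nonpos:
  assumes "(x, \<mu>) \<in> pd_domain X"
  shows "((x, \<mu>) - (xs, \<mu>s)) \<bullet> pd_field f g \<rho> (x, \<mu>) \<le> 0"
    and "((x, \<mu>) - (xs, \<mu>s)) \<bullet> pd_field f g \<rho> (x, \<mu>) = 0 \<Longrightarrow>
      gap_f xs x = 0 \<and> (\<forall>i. \<mu> $ i * gap_g i x xs = 0) \<and> (\<forall>i. \<mu>s $ i * gap_g i xs x = 0) \<and>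
      (\<forall>i. \<mu> $ i * g xs $ i = 0) \<and> (\<forall>i. \<rho> * (max 0 (g x $ i))\<^sup>2 = 0)"
proof -
  have x: "x \<in> X" and \<mu>: "0 \<le> \<mu> $ i" for i
    using assms by (auto simp: pd_domain_def less_eq_vec_def)
  let ?S = "(x - xs) \<bullet> gradient f xs + (\<Sum>i\<in>UNIV. \<mu>s $ i * ((x - xs) \<bullet> grad_g i xs))"
  let ?a = "\<lambda>i. \<mu> $ i * gap_g i x xs" and ?b = "\<lambda>i. \<mu>s $ i * gap_g i xs x"
  let ?c = "\<lambda>i. \<mu> $ i * - g xs $ i"
  let ?d = "\<lambda>i. \<rho> * max 0 (g x $ i) * (g x $ i + gap_g i x xs - g xs $ i)"
  have terms: "0 \<le> ?a i" "0 \<le> ?b i" "0 \<le> ?c i" "0 \<le> \<rho> * (max 0 (g x $ i))\<^sup>2" for i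
    using \<mu>[of i] solution_mult[of i] gap_nonneg(2) solution_feasible(2)[of i] rho_nonneg
    by (auto intro: mult_nonneg_nonpos)
  have d: "0 \<le> ?d i" for i
    using terms(4)[of i] augmentation_nonneg[of x i] by linarith
  have sums: "0 \<le> sum ?a UNIV" "0 \<le> sum ?b UNIV" "0 \<le> sum ?c UNIV" "0 \<le> sum ?d UNIV"
    using terms(1,2,3) d by (auto intro!: sum_nonneg simp del: mult_minus_right)
  note nonneg = gap_nonneg(1)[of x xs] gap_nonneg(1)[of xs x] stationarity[OF x] sums
  show "((x, \<mu>) - (xs, \<mu>s)) \<bullet> pd_field f g \<rho> (x, \<mu>) \<le> 0"
    using dissipation_identity[of x \<mu>] nonneg by linarith
  assume "((x, \<mu>) - (xs, \<mu>s)) \<bullet> pd_field f g \<rho> (x, \<mu>) = 0"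
  then have zero: "gap_f xs x = 0" "sum ?a UNIV = 0" "sum ?b UNIV = 0" "sum ?c UNIV = 0" "sum ?d UNIV = 0"
    using dissipation_identity[of x \<mu>] nonneg by linarith+
  have "?a i = 0" "?b i = 0" "?c i = 0" "?d i = 0" for i
    using zero(2-) terms(1,2,3) d
    by (simp_all only: sum_nonneg_eq_0_iff[OF finite_class.finite_UNIV] UNIV_I simp_thms Ball_def)
  \<comment> \<open>The last conjunct holds because the penalty is squeezed between 0 and the
    vanishing term \<open>?d i\<close>.\<close>
  then show "gap_f xs x = 0 \<and> (\<forall>i. \<mu> $ i * gap_g i x xs = 0) \<and> (\<forall>i. \<mu>s $ i * gap_g i xs x = 0) \<and>
      (\<forall>i. \<mu> $ i * g xs $ i = 0) \<and> (\<forall>i. \<rho> * (max 0 (g x $ i))\<^sup>2 = 0)"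
    using zero(1) terms(4) augmentation_nonneg[of x]
    by (metis add.inverse_inverse mult_minus_right neg_0_equal_iff_equal order_antisym)
qed

section \<open>Points of zero dissipation and their closure\<close>

text \<open>The direction from \<open>z\<close> to the solution is tangent, so its pairing with the
  residual is nonpositive. At zero projected dissipation this pairing is minus the dissipation of
  the raw field, hence also nonnegative.\<close>

lemma zero_dissipation_pointD:
  assumes "z \<in> zero_dissipation_points X f g \<rho> (xs, \<mu>s)"
  defines "\<eta> \<equiv> pd_field f g \<rho> z - tangent_proj (pd_domain X) z (pd_field f g \<rho> z)"
  shows "z \<in> pd_domain X" and "(z - (xs, \<mu>s)) \<bullet> pd_field f g \<rho> z = 0"
    and "((xs, \<mu>s) - z) \<bullet> \<eta> = 0"
proof -
  let ?P = "tangent_proj (pd_domain X) z (pd_field f g \<rho> z)"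
  show z: "z \<in> pd_domain X"
    using assms(1) by (simp add: zero_dissipation_points_def)
  have P: "(z - (xs, \<mu>s)) \<bullet> ?P = 0"
    using assms(1) by (simp add: zero_dissipation_points_def)
  have "((xs, \<mu>s) - z) \<bullet> \<eta> \<le> 0"
    unfolding \<eta>_def using solution_mem(2) z convex_pd_domain[OF convex_X]
    by (intro tangent_proj_residual diff_mem_tangent_cone) auto
  moreover have "((xs, \<mu>s) - z) \<bullet> \<eta> = - ((z - (xs, \<mu>s)) \<bullet> pd_field f g \<rho> z)"
    using P unfolding \<eta>_def by (simp add: inner_diff_left inner_diff_right)
  moreover have "(z - (xs, \<mu>s)) \<bullet> pd_field f g \<rho> z \<le> 0"
    using dissipation_nonpos(1) z by (cases z) blast
  ultimately show "(z - (xs, \<mu>s)) \<bullet> pd_field f g \<rho> z = 0" "((xs, \<mu>s) - z) \<bullet> \<eta> = 0"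
    by linarith+
qed

text \<open>The gaps are based at \<open>xs\<close>, not at \<open>x\<close>: in this form all the conditions are closed
  without appeal to continuity of the gradients.\<close>

lemma zero_dissipation_setD:
  assumes "(x, \<mu>) \<in> zero_dissipation_set X f g \<rho> (xs, \<mu>s)"
  shows "(x, \<mu>) \<in> pd_domain X" and "gap_f xs x = 0"
    and "\<mu> $ i * gap_g i xs x = 0" and "\<mu>s $ i * gap_g i xs x = 0"
    and "\<mu> $ i * g xs $ i = 0" and "\<rho> * (max 0 (g x $ i))\<^sup>2 = 0"
proof -
  let ?S = "\<lambda>i. {z. gap_f xs (fst z) = 0} \<inter> {z. snd z $ i * gap_g i xs (fst z) = 0}
    \<inter> {z. \<mu>s $ i * gap_g i xs (fst z) = 0} \<inter> {z. snd z $ i * g xs $ i = 0}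
    \<inter> {z. \<rho> * (max 0 (g (fst z) $ i))\<^sup>2 = 0}"
  have cont: "continuous_on UNIV f" "continuous_on UNIV g"
    by (auto simp: continuous_on_eq_continuous_within
        intro!: differentiable_imp_continuous_within diff_f diff_g)
  have cont': "continuous_on UNIV (\<lambda>z::(real^'n) \<times> (real^'m). f (fst z))"
    "continuous_on UNIV (\<lambda>z::(real^'n) \<times> (real^'m). g (fst z))"
    by (auto intro!: continuous_on_compose2[OF cont(1)] continuous_on_compose2[OF cont(2)]
        continuous_intros)
  have cl: "closed (pd_domain X \<inter> (\<Inter>i. ?S i))"
    unfolding gap_f_def gap_g_def
    by (intro closed_Int closed_INT ballI closed_pd_domain closed_X closed_Collect_eq
        continuous_intros cont')
  have "zero_dissipation_points X f g \<rho> (xs, \<mu>s) \<subseteq> pd_domain X \<inter> (\<Inter>i. ?S i)"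
  proof
    fix z assume z: "z \<in> zero_dissipation_points X f g \<rho> (xs, \<mu>s)"
    obtain y \<nu> where yv: "z = (y, \<nu>)" by (cases z)
    note zero = dissipation_nonpos(2)[OF zero_dissipation_pointD(1,2)[OF z, unfolded yv]]
    \<comment> \<open>The base point is exchanged here: a vanishing gap based at \<open>y\<close>
      makes the gradients at \<open>y\<close> and \<open>xs\<close> equal, and with equal gradients
      the two gaps are negatives of each other.\<close>
    have "\<nu> $ i = 0 \<or> gap_g i xs y = 0" for i
    proof (cases "\<nu> $ i = 0")
      case False
      then have gap: "gap_g i y xs = 0" using zero by (metis mult_eq_0_iff)
      show ?thesis using gap gap_g_eq_0D[OF gap] by (simp add: gap_g_def inner_diff_left)
    qed simp
    then show "z \<in> pd_domain X \<inter> (\<Inter>i. ?S i)"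
      using zero zero_dissipation_pointD(1)[OF z] by (simp add: yv)
  qed
  from closure_minimal[OF this cl] assms
  have "(x, \<mu>) \<in> pd_domain X \<inter> (\<Inter>i. ?S i)"
    unfolding zero_dissipation_set_def by blast
  then show "(x, \<mu>) \<in> pd_domain X" "gap_f xs x = 0"
    "\<mu> $ i * gap_g i xs x = 0" "\<mu>s $ i * gap_g i xs x = 0"
    "\<mu> $ i * g xs $ i = 0" "\<rho> * (max 0 (g x $ i))\<^sup>2 = 0"
    by auto
qed

text \<open>If \<open>\<mu> i = 0\<close> and \<open>g i x < 0\<close>, the projection onto the tangent cone must change the \<open>\<mu> i\<close>
  component of the field.  Splitting \<open>zs - z\<close> into its \<open>\<mu> i\<close> component and the rest gives two
  tangent vectors, so the residual is orthogonal to both; but the first pairing is nonzero.\<close>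

lemma strict_complementarity_point:
  assumes z: "(x, \<mu>) \<in> zero_dissipation_points X f g \<rho> (xs, \<mu>s)" and pos: "0 < \<mu>s $ i"
  shows "0 < \<mu> $ i \<or> 0 \<le> g x $ i"
proof (rule ccontr)
  let ?Z = "pd_domain X :: ((real^'n) \<times> (real^'m)) set"
  let ?P = "tangent_proj ?Z (x, \<mu>) (pd_field f g \<rho> (x, \<mu>))"
  let ?\<eta> = "pd_field f g \<rho> (x, \<mu>) - ?P"
  let ?v = "(0, axis i (\<mu>s $ i)) :: (real^'n) \<times> (real^'m)"
  assume neg: "\<not> (0 < \<mu> $ i \<or> 0 \<le> g x $ i)"
  note mem = zero_dissipation_pointD(1)[OF z]
  have x: "x \<in> X" and \<mu>: "0 \<le> \<mu> $ j" for j
    using mem by (auto simp: pd_domain_def less_eq_vec_def)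
  have \<mu>i: "\<mu> $ i = 0" using neg \<mu>[of i] by simp
  note conv = convex_pd_domain[OF convex_X]
  \<comment> \<open>The first point raises the \<open>i\<close>-th multiplier by
    \<open>\<mu>s $ i\<close>. The second is the solution with its \<open>i\<close>-th multiplier
    reset to zero.\<close>
  have "(x, \<mu>) + ?v \<in> ?Z" "(x, \<mu>) + ((xs, \<mu>s) - (x, \<mu>) - ?v) \<in> ?Z"
    using x \<mu> pos solution_mem(1) solution_mult
    by (auto simp: pd_domain_def less_eq_vec_def axis_def)
  then have "?v \<bullet> ?\<eta> \<le> 0" "((xs, \<mu>s) - (x, \<mu>) - ?v) \<bullet> ?\<eta> \<le> 0"
    using tangent_proj_residual[OF conv mem] diff_mem_tangent_cone by blast+
  \<comment> \<open>The two nonpositive pairings add up to the pairing of the full displacement,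
    which is zero.\<close>
  then have "?v \<bullet> ?\<eta> = 0"
    using zero_dissipation_pointD(3)[OF z] inner_diff_left[of "(xs, \<mu>s) - (x, \<mu>)" ?v ?\<eta>]
    by linarith
  then have "\<mu>s $ i * snd ?\<eta> $ i = 0"
    by (simp add: inner_prod_def inner_axis')
  then have "snd ?P $ i = g x $ i"
    using pos by (simp add: pd_field_explicit[OF diff_f diff_g])
  \<comment> \<open>Since \<open>\<mu> $ i = 0\<close>, a feasible direction cannot decrease this
    coordinate, and the closed condition survives the closure. The projected component is therefore
    nonnegative, yet it equals the negative value \<open>g x $ i\<close>.\<close>
  moreover have "tangent_cone ?Z (x, \<mu>) \<subseteq> {v. 0 \<le> snd v $ i}"
    unfolding tangent_cone_def
  proof (rule closure_minimal)
    show "{v. \<exists>s>0. (x, \<mu>) + s *\<^sub>R v \<in> ?Z} \<subseteq> {v. 0 \<le> snd v $ i}"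
    proof clarify
      fix a :: "real^'n" and b :: "real^'m" and s :: real
      assume "0 < s" "(x, \<mu>) + s *\<^sub>R (a, b) \<in> ?Z"
      then have "0 \<le> (\<mu> + s *\<^sub>R b) $ i"
        by (simp add: pd_domain_def less_eq_vec_def)
      then show "0 \<le> snd (a, b) $ i"
        using \<open>0 < s\<close> \<mu>i by (simp add: zero_le_mult_iff)
    qed
    show "closed {v::(real^'n) \<times> (real^'m). 0 \<le> snd v $ i}"
      by (intro closed_Collect_le continuous_intros)
  qed
  then have "0 \<le> snd ?P $ i"
    using tangent_proj_mem[OF conv mem] by blast
  ultimately show False
    using neg by simp
qed

end

theorem proposition4:
  fixes f :: "real^'n \<Rightarrow> real"
    and g :: "real^'n \<Rightarrow> real^'m"
    and X :: "(real^'n) set"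
    and \<rho> :: real
    and xs :: "real^'n"
    and \<mu>s :: "real^'m"
  assumes "convex_on UNIV f"
    and "\<forall>i. convex_on UNIV (\<lambda>x. g x $ i)"
    and "\<forall>x. f differentiable (at x)"
    and "\<forall>x. g differentiable (at x)"
    and "closed X" and "convex X"
    and optimizer_exists: "\<exists>x\<in>X. g x \<le> 0 \<and> (\<forall>y\<in>X. g y \<le> 0 \<longrightarrow> f x \<le> f y)"
    and slater: "rel_interior {x \<in> X. g x \<le> 0} \<noteq> {}"
    and "0 \<le> \<rho>"
    and "pd_solution X f g (xs, \<mu>s)"
  shows
    "(0 < \<rho> \<or> strictly_convex_on UNIV f \<longrightarrow>
        zero_dissipation_set X f g \<rho> (xs, \<mu>s) \<subseteq> {(x, \<mu>) \<in> pd_domain X. g x \<le> 0}) \<and>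
     (\<forall>(x, \<mu>) \<in> zero_dissipation_set X f g \<rho> (xs, \<mu>s). gradient f x = gradient f xs) \<and>
     (\<forall>(x, \<mu>) \<in> zero_dissipation_set X f g \<rho> (xs, \<mu>s). \<forall>i.
        \<mu>s $ i = 0 \<or> g x $ i = g xs $ i + gradient (\<lambda>y. g y $ i) xs \<bullet> (x - xs)) \<and>
     (\<forall>(x, \<mu>) \<in> zero_dissipation_set X f g \<rho> (xs, \<mu>s).
        gradient_matrix g x *v \<mu> = gradient_matrix g xs *v \<mu>) \<and>
     (\<forall>(x, \<mu>) \<in> zero_dissipation_set X f g \<rho> (xs, \<mu>s). \<forall>i.
        g xs $ i < 0 \<longrightarrow> \<mu> $ i = 0) \<and>
     ((\<forall>i. g xs $ i = 0 \<longrightarrow> 0 < \<mu>s $ i) \<longrightarrow>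
        (\<forall>(x, \<mu>) \<in> zero_dissipation_points X f g \<rho> (xs, \<mu>s). \<forall>i.
           g xs $ i = 0 \<longrightarrow> 0 < \<mu> $ i \<or> 0 \<le> g x $ i))"
proof -
  interpret convex_program f g X \<rho> xs \<mu>s
    using assms by unfold_locales auto
  let ?M = "zero_dissipation_set X f g \<rho> (xs, \<mu>s)"
  note D = zero_dissipation_setD
  have "?M \<subseteq> {(x, \<mu>) \<in> pd_domain X. g x \<le> 0}" if "0 < \<rho> \<or> strictly_convex_on UNIV f"
  proof clarify
    fix x \<mu> assume M: "(x, \<mu>) \<in> ?M"
    from that have "g x \<le> 0"
    proof
      assume "0 < \<rho>"
      then have "max 0 (g x $ i) = 0" for i using D(6)[OF M, of i] by simp
      then show ?thesis by (metis less_eq_vec_def max.cobounded2 zero_index)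
    next
      assume "strictly_convex_on UNIV f"
      from strictly_convex_touches_tangent[OF this convex_f diff_f] D(2)[OF M]
      have "x = xs" by (simp add: gap_f_def)
      then show ?thesis using solution_feasible(1) by simp
    qed
    then show "(x, \<mu>) \<in> pd_domain X \<and> g x \<le> 0" using D(1)[OF M] by simp
  qed
  moreover have "gradient f x = gradient f xs" if "(x, \<mu>) \<in> ?M" for x \<mu>
    using D(2)[OF that] by (rule gap_f_eq_0D)
  moreover have "\<mu>s $ i = 0 \<or> g x $ i = g xs $ i + gradient (\<lambda>y. g y $ i) xs \<bullet> (x - xs)"
    if "(x, \<mu>) \<in> ?M" for x \<mu> i
    using D(4)[OF that, of i] by (auto simp: gap_g_def inner_commute)
  moreover have "gradient_matrix g x *v \<mu> = gradient_matrix g xs *v \<mu>"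
    if "(x, \<mu>) \<in> ?M" for x \<mu>
  proof -
    \<comment> \<open>A column of the gradient matrix can differ between \<open>x\<close> and
      \<open>xs\<close> only where its weight \<open>\<mu> $ i\<close> is zero.\<close>
    have "\<mu> $ i = 0 \<or> grad_g i x = grad_g i xs" for i
      using D(3)[OF that, of i] gap_g_eq_0D by auto
    then have "h \<bullet> (gradient_matrix g x *v \<mu>) = h \<bullet> (gradient_matrix g xs *v \<mu>)" for h
      unfolding inner_gradient_matrix by (intro sum.cong refl) (metis mult_zero_left)
    then show ?thesis
      using vector_eq_ldot by blast
  qed
  moreover have "\<mu> $ i = 0" if "(x, \<mu>) \<in> ?M" "g xs $ i < 0" for x \<mu> i
    using D(5)[OF that(1), of i] that(2) by simp
  moreover note strict_complementarity_point
  ultimately show ?thesis by blast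
qed

end
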